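(* Let $\mathfrak{T}$ be the graph defined in the context, with root $x_0=z_0^{(0)}$. The boundary group $\mathscr{B}_1$ of $\mathfrak{T}$ at level $1$ is an infinite torsion normal subgroup of $\mathcal{G}(\mathfrak{T})$ all of whose nontrivial elements have order two. Moreover, $\mathcal{G}(\mathfrak{T})/\mathscr{B}_1\simeq\mathbb{Z}$.
   Context: The transition group $\mathcal{G}(\Gamma)$ of a connected directed graph $\Gamma$ whose edges are labeled by a finite alphabet $A$ closed under inversion, with each edge $v\xrightarrow{x}w$ having an inverse edge $w\xrightarrow{x^{-1}}v$, and with exactly one outgoing $x$-edge at every vertex for every $x\in A$, is the group of permutations of the vertex set generated by the permutations $v\mapsto v\cdot x$ ($x\in A$), where $v\cdot x$ is the endpoint of the $x$-edge at $v$. Let $\pi:A^*\to\mathcal{G}(\Gamma)$ be the natural map. The graph $\mathfrak{T}$ over $A=\{a,a^{-1},c,c^{-1}\}$ has vertices $z_i^{(j)}$, $i\in\mathbb{Z}$, $j\in\{0,1\}$, and edges (together with their inverses): $z_i^{(j)}\xrightarrow{c}z_{i+1}^{(j)}$ for all $i,j$; $z_0^{(j)}\xrightarrow{a}z_0^{(j+1\bmod 2)}$ for $j\in\{0,1\}$; and loops $z_i^{(j)}\xrightarrow{a}z_i^{(j)}$ for all $i\ne0$ and $j\in\{0,1\}$. (Two $c$-lines whose level-zero vertices are exchanged by $a$ and by $a^{-1}$, with $a$-loops at all other vertices.) Boundary group: let $(\Gamma,x_0)$ be a rooted graph, that is, a connected directed graph $\Gamma$ whose edges are labeled by a finite alphabet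 $A$ closed under inversion, with each edge $v\xrightarrow{x}w$ having an inverse edge $w\xrightarrow{x^{-1}}v$, and with exactly one outgoing $x$-edge at every vertex for every $x\in A$, together with a chosen vertex $x_0$ of $\Gamma$ (the root). For $n\ge1$, let $D_n(x_0)$ be the set of vertices at path distance at most $n$ from $x_0$, $\Lambda_n=\Gamma\setminus D_n(x_0)$ the subgraph left after removing $D_n(x_0)$, and $\mathcal{O}_n$ the set of words $u\in A^*$ such that whenever $x\xrightarrow{u}x'$ is a walk contained in $\Lambda_n$ one has $x=x'$. The boundary group at level $n$ is $\mathscr{B}_n=\pi(\mathcal{O}_n)$, a normal subgroup of $\mathcal{G}(\Gamma)$. *)

theory Defs
  imports "HOL-Algebra.Algebra"
begin

text \<open>An edge from \<open>v\<close> to \<open>w\<close> labeled \<open>x\<close> is the triple \<open>(v, x, w)\<close>; as there is exactly one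
  outgoing edge per vertex and letter, no multiplicities get lost.  The field \<open>linv\<close> is the formal
  inversion of letters.\<close>

record ('v, 'x) lgraph =
  verts :: "'v set"
  alph :: "'x set"
  linv :: "'x \<Rightarrow> 'x"
  edges :: "('v \<times> 'x \<times> 'v) set"

inductive walk :: "('v, 'x) lgraph \<Rightarrow> 'v \<Rightarrow> 'x list \<Rightarrow> 'v \<Rightarrow> bool" for \<Gamma> where
  Nil: "v \<in> verts \<Gamma> \<Longrightarrow> walk \<Gamma> v [] v"
| Cons: "(v, x, w) \<in> edges \<Gamma> \<Longrightarrow> walk \<Gamma> w u w' \<Longrightarrow> walk \<Gamma> v (x # u) w'"

locale transition_graph =
  fixes \<Gamma> :: "('v, 'x) lgraph"
  assumes finite_alph: "finite (alph \<Gamma>)"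
    and linv_closed: "x \<in> alph \<Gamma> \<Longrightarrow> linv \<Gamma> x \<in> alph \<Gamma>"
    and linv_linv: "x \<in> alph \<Gamma> \<Longrightarrow> linv \<Gamma> (linv \<Gamma> x) = x"
    and edges_wf: "edges \<Gamma> \<subseteq> verts \<Gamma> \<times> alph \<Gamma> \<times> verts \<Gamma>"
    and inverse_edge: "(v, x, w) \<in> edges \<Gamma> \<Longrightarrow> (w, linv \<Gamma> x, v) \<in> edges \<Gamma>"
    and unique_out: "v \<in> verts \<Gamma> \<Longrightarrow> x \<in> alph \<Gamma> \<Longrightarrow> \<exists>!w. (v, x, w) \<in> edges \<Gamma>"
    and connected: "v \<in> verts \<Gamma> \<Longrightarrow> w \<in> verts \<Gamma> \<Longrightarrow> \<exists>u. walk \<Gamma> v u w"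

locale rooted_graph = transition_graph +
  fixes x\<^sub>0
  assumes root: "x\<^sub>0 \<in> verts \<Gamma>"

text \<open>Permutations act on the right here, so products are read from left to right: this is the
  opposite of the multiplication of \<^const>\<open>BijGroup\<close>, and it makes the natural map from words a
  homomorphism.\<close>

definition right_perm_group :: "'v set \<Rightarrow> ('v \<Rightarrow> 'v) monoid" where
  "right_perm_group V = (BijGroup V)\<lparr>mult := \<lambda>f g. g \<otimes>\<^bsub>BijGroup V\<^esub> f\<rparr>"

definition letter_perm :: "('v, 'x) lgraph \<Rightarrow> 'x \<Rightarrow> 'v \<Rightarrow> 'v" where
  "letter_perm \<Gamma> x = (\<lambda>v\<in>verts \<Gamma>. THE w. (v, x, w) \<in> edges \<Gamma>)"

definition transition_group :: "('v, 'x) lgraph \<Rightarrow> ('v \<Rightarrow> 'v) monoid" where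
  "transition_group \<Gamma> =
     subgroup_generated (right_perm_group (verts \<Gamma>)) (letter_perm \<Gamma> ` alph \<Gamma>)"

definition word_perm :: "('v, 'x) lgraph \<Rightarrow> 'x list \<Rightarrow> 'v \<Rightarrow> 'v" where
  "word_perm \<Gamma> u =
     foldr (\<lambda>x g. letter_perm \<Gamma> x \<otimes>\<^bsub>transition_group \<Gamma>\<^esub> g) u \<one>\<^bsub>transition_group \<Gamma>\<^esub>"

text \<open>Only meaningful when some walk joins the two vertices, as is always the case in a connected
  graph.\<close>

definition path_dist :: "('v, 'x) lgraph \<Rightarrow> 'v \<Rightarrow> 'v \<Rightarrow> nat" where
  "path_dist \<Gamma> v w = (LEAST n. \<exists>u. length u = n \<and> walk \<Gamma> v u w)"

definition disc :: "('v, 'x) lgraph \<Rightarrow> 'v \<Rightarrow> nat \<Rightarrow> 'v set" where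
  "disc \<Gamma> x\<^sub>0 n = {v \<in> verts \<Gamma>. path_dist \<Gamma> x\<^sub>0 v \<le> n}"

definition delete_verts :: "('v, 'x) lgraph \<Rightarrow> 'v set \<Rightarrow> ('v, 'x) lgraph" where
  "delete_verts \<Gamma> D = \<Gamma>\<lparr>verts := verts \<Gamma> - D,
     edges := {(v, x, w) \<in> edges \<Gamma>. v \<notin> D \<and> w \<notin> D}\<rparr>"

definition outer_words :: "('v, 'x) lgraph \<Rightarrow> 'v \<Rightarrow> nat \<Rightarrow> 'x list set" where
  "outer_words \<Gamma> x\<^sub>0 n = {u \<in> lists (alph \<Gamma>).
     \<forall>x x'. walk (delete_verts \<Gamma> (disc \<Gamma> x\<^sub>0 n)) x u x' \<longrightarrow> x = x'}"

definition boundary_group :: "('v, 'x) lgraph \<Rightarrow> 'v \<Rightarrow> nat \<Rightarrow> ('v \<Rightarrow> 'v) set" where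
  "boundary_group \<Gamma> x\<^sub>0 n = word_perm \<Gamma> ` outer_words \<Gamma> x\<^sub>0 n"

datatype letter = La | La_inv | Lc | Lc_inv

fun letter_inv :: "letter \<Rightarrow> letter" where
  "letter_inv La = La_inv"
| "letter_inv La_inv = La"
| "letter_inv Lc = Lc_inv"
| "letter_inv Lc_inv = Lc"

text \<open>The vertex $z_i^{(j)}$ is the pair \<open>(i, j)\<close>.\<close>

definition T_positive_edges :: "((int \<times> nat) \<times> letter \<times> (int \<times> nat)) set" where
  "T_positive_edges =
     {((i, j), Lc, (i + 1, j)) | i j. j \<in> {0, 1}}
   \<union> {((0, j), La, (0, (j + 1) mod 2)) | j. j \<in> {0, 1}}
   \<union> {((i, j), La, (i, j)) | i j. i \<noteq> 0 \<and> j \<in> {0, 1}}"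

definition T_graph :: "(int \<times> nat, letter) lgraph" where
  "T_graph =
     \<lparr>verts = UNIV \<times> {0, 1},
      alph = {La, La_inv, Lc, Lc_inv},
      linv = letter_inv,
      edges = T_positive_edges \<union> {(w, letter_inv x, v) | v x w. (v, x, w) \<in> T_positive_edges}\<rparr>"


lemma group_right_perm_group: "group (right_perm_group V)"
proof -
  interpret B: group "BijGroup V" by (rule group_BijGroup)
  show ?thesis
  proof (rule groupI)
    fix x assume "x \<in> carrier (right_perm_group V)"
    then show "\<exists>y\<in>carrier (right_perm_group V). y \<otimes>\<^bsub>right_perm_group V\<^esub> x = \<one>\<^bsub>right_perm_group V\<^esub>"
      by (intro bexI[of _ "inv\<^bsub>BijGroup V\<^esub> x"]) (auto simp: right_perm_group_def)
  qed (auto simp: right_perm_group_def B.m_assoc)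
qed

lemma group_transition_group: "group (transition_group \<Gamma>)"
  unfolding transition_group_def
  by (rule group.group_subgroup_generated[OF group_right_perm_group])

context transition_graph
begin

lemma letter_perm_edge:
  assumes "v \<in> verts \<Gamma>" "x \<in> alph \<Gamma>"
  shows "(v, x, letter_perm \<Gamma> x v) \<in> edges \<Gamma>"
  using theI'[OF unique_out[OF assms]] assms by (simp add: letter_perm_def)

lemma letter_perm_closed: "v \<in> verts \<Gamma> \<Longrightarrow> x \<in> alph \<Gamma> \<Longrightarrow> letter_perm \<Gamma> x v \<in> verts \<Gamma>"
  using letter_perm_edge edges_wf by blast

lemma letter_perm_linv:
  assumes "v \<in> verts \<Gamma>" "x \<in> alph \<Gamma>"
  shows "letter_perm \<Gamma> (linv \<Gamma> x) (letter_perm \<Gamma> x v) = v"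
  using assms unique_out inverse_edge letter_perm_edge letter_perm_closed linv_closed by metis

text \<open>Hence the intersection with the carrier in the definition of \<^const>\<open>subgroup_generated\<close>
  does not discard any generator.\<close>

lemma letter_perm_Bij:
  assumes x: "x \<in> alph \<Gamma>"
  shows "letter_perm \<Gamma> x \<in> carrier (right_perm_group (verts \<Gamma>))"
proof -
  have "bij_betw (letter_perm \<Gamma> x) (verts \<Gamma>) (verts \<Gamma>)"
    using x letter_perm_closed letter_perm_linv letter_perm_linv[OF _ linv_closed[OF x]]
      linv_closed linv_linv
    by (intro bij_betw_byWitness[where f' = "letter_perm \<Gamma> (linv \<Gamma> x)"]) auto
  then show ?thesis
    by (simp add: right_perm_group_def BijGroup_def Bij_def letter_perm_def)
qed

lemma letter_perm_carrier:
  assumes "x \<in> alph \<Gamma>"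
  shows "letter_perm \<Gamma> x \<in> carrier (transition_group \<Gamma>)"
  using assms letter_perm_Bij
  by (auto simp: transition_group_def carrier_subgroup_generated intro!: generate.incl)

lemma word_perm_carrier: "u \<in> lists (alph \<Gamma>) \<Longrightarrow> word_perm \<Gamma> u \<in> carrier (transition_group \<Gamma>)"
proof (induction u rule: lists.induct)
  interpret group "transition_group \<Gamma>" by (rule group_transition_group)
  { case Nil then show ?case by (simp add: word_perm_def) }
  { case (Cons x u) then show ?case using letter_perm_carrier[of x] by (simp add: word_perm_def) }
qed

lemma word_perm_append:
  assumes "u \<in> lists (alph \<Gamma>)" "w \<in> lists (alph \<Gamma>)"
  shows "word_perm \<Gamma> (u @ w) = word_perm \<Gamma> u \<otimes>\<^bsub>transition_group \<Gamma>\<^esub> word_perm \<Gamma> w"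
  using assms(1)
proof (induction u rule: lists.induct)
  interpret group "transition_group \<Gamma>" by (rule group_transition_group)
  { case Nil then show ?case using word_perm_carrier[OF assms(2)] by (simp add: word_perm_def) }
  { case (Cons x u)
    then show ?case
      using letter_perm_carrier[of x] word_perm_carrier[of u] word_perm_carrier[OF assms(2)]
      by (simp add: word_perm_def m_assoc) }
qed

lemma carrier_transition_group_subset: "carrier (transition_group \<Gamma>) \<subseteq> Bij (verts \<Gamma>)"
proof -
  have "carrier (transition_group \<Gamma>) \<subseteq> carrier (right_perm_group (verts \<Gamma>))"
    unfolding transition_group_def
    by (rule group.carrier_subgroup_generated_subset[OF group_right_perm_group])
  then show ?thesis by (simp add: right_perm_group_def BijGroup_def)
qed

lemma walk_word_perm:
  assumes "u \<in> lists (alph \<Gamma>)" "v \<in> verts \<Gamma>"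
  shows "walk \<Gamma> v u (word_perm \<Gamma> u v)"
  using assms
proof (induction u arbitrary: v rule: lists.induct)
  case Nil
  then show ?case
    by (simp add: word_perm_def transition_group_def right_perm_group_def BijGroup_def
        subgroup_generated_def walk.Nil)
next
  case (Cons x u)
  then have x: "x \<in> alph \<Gamma>" and u: "u \<in> lists (alph \<Gamma>)" and v: "v \<in> verts \<Gamma>" by auto
  have bx: "letter_perm \<Gamma> x \<in> Bij (verts \<Gamma>)" and bu: "word_perm \<Gamma> u \<in> Bij (verts \<Gamma>)"
    using letter_perm_carrier[OF x] word_perm_carrier[OF u] carrier_transition_group_subset by auto
  have "word_perm \<Gamma> (x # u) = letter_perm \<Gamma> x \<otimes>\<^bsub>transition_group \<Gamma>\<^esub> word_perm \<Gamma> u"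
    by (simp add: word_perm_def)
  also have "\<dots> = compose (verts \<Gamma>) (word_perm \<Gamma> u) (letter_perm \<Gamma> x)"
    using bx bu
    by (simp add: transition_group_def right_perm_group_def BijGroup_def subgroup_generated_def)
  finally have "word_perm \<Gamma> (x # u) v = word_perm \<Gamma> u (letter_perm \<Gamma> x v)"
    using v by (simp add: compose_def)
  then show ?case
    using Cons.IH[OF letter_perm_closed[OF v x]] letter_perm_edge[OF v x]
    by (auto intro: walk.Cons)
qed

end

lemma T_edges_iff:
  "((i, j), x, (i', j')) \<in> edges T_graph \<longleftrightarrow> j \<in> {0, 1} \<and>
     (case x of Lc \<Rightarrow> i' = i + 1 \<and> j' = j
      | Lc_inv \<Rightarrow> i' = i - 1 \<and> j' = j
      | _ \<Rightarrow> i' = i \<and> j' = (if i = 0 then 1 - j else j))"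
  by (cases x) (auto simp: T_graph_def T_positive_edges_def elim: letter_inv.elims)

lemma T_graph_linv: "linv T_graph = letter_inv"
  by (simp add: T_graph_def)

lemma walk_append: "walk \<Gamma> v u w \<Longrightarrow> walk \<Gamma> w u' w' \<Longrightarrow> walk \<Gamma> v (u @ u') w'"
  by (induction rule: walk.induct) (auto intro: walk.intros)

lemma walk_T_up: "j \<in> {0, 1} \<Longrightarrow> walk T_graph (i, j) (replicate n Lc) (i + int n, j)"
proof (induction n arbitrary: i)
  case 0 then show ?case by (auto intro!: walk.Nil simp: T_graph_def)
next
  case (Suc n)
  then show ?case
    using Suc.IH[of "i + 1"] by (auto intro!: walk.Cons[of _ _ "(i + 1, j)"] simp: T_edges_iff add.assoc)
qed

lemma walk_T_down: "j \<in> {0, 1} \<Longrightarrow> walk T_graph (i, j) (replicate n Lc_inv) (i - int n, j)"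
proof (induction n arbitrary: i)
  case 0 then show ?case by (auto intro!: walk.Nil simp: T_graph_def)
next
  case (Suc n)
  then show ?case
    using Suc.IH[of "i - 1"]
    by (auto intro!: walk.Cons[of _ _ "(i - 1, j)"] simp: T_edges_iff diff_diff_eq)
qed

lemma walk_T_line: "j \<in> {0, 1} \<Longrightarrow> \<exists>u. walk T_graph (i, j) u (i', j)"
  using walk_T_up[of j i "nat (i' - i)"] walk_T_down[of j i "nat (i - i')"]
  by (cases "i \<le> i'") auto

theorem rooted_graph_T: "rooted_graph T_graph (0, 0)"
proof
  fix v w assume "v \<in> verts T_graph" "w \<in> verts T_graph"
  then obtain i j i' j' where vw: "v = (i, j)" "w = (i', j')" and j: "j \<in> {0, 1}" "j' \<in> {0, 1}"
    by (auto simp: T_graph_def)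
  obtain u1 where u1: "walk T_graph (i, j) u1 (0, j)" using walk_T_line j by blast
  obtain u2 where u2: "walk T_graph (0, j') u2 (i', j')" using walk_T_line j by blast
  have "\<exists>u. walk T_graph (0, j) u (0, j')"
  proof (cases "j = j'")
    case True then show ?thesis using walk_T_line j by blast
  next
    case False
    then have "((0, j), La, (0, j')) \<in> edges T_graph" using j by (auto simp: T_edges_iff)
    moreover have "walk T_graph (0, j') [] (0, j')"
      using j by (intro walk.Nil) (simp add: T_graph_def)
    ultimately show ?thesis by (blast intro: walk.Cons)
  qed
  then show "\<exists>u. walk T_graph v u w" using u1 u2 vw walk_append by metis
next
  fix v x assume "v \<in> verts T_graph" "x \<in> alph T_graph"
  then obtain i j where v: "v = (i, j)" and j: "j \<in> {0, 1}" by (auto simp: T_graph_def)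
  then show "\<exists>!w. (v, x, w) \<in> edges T_graph"
    by (cases x) (auto simp: T_edges_iff split_paired_Ex Ex1_def)
next
  fix v x w assume "(v, x, w) \<in> edges T_graph"
  then show "(w, linv T_graph x, v) \<in> edges T_graph"
    by (cases v; cases w; cases x) (auto simp: T_edges_iff T_graph_linv split: if_splits)
next
  show "edges T_graph \<subseteq> verts T_graph \<times> alph T_graph \<times> verts T_graph"
    by (auto simp: T_graph_def T_positive_edges_def)
next
  fix x assume "x \<in> alph T_graph"
  then show "linv T_graph x \<in> alph T_graph" "linv T_graph (linv T_graph x) = x"
    by (auto simp: T_graph_def)
qed (auto simp: T_graph_def)

end

theory Submission
  imports Defs
begin

text \<open>The \<open>c\<close>-exponent of a word \<open>u\<close> is a number that its permutation remembers: \<open>a\<close> never changes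
  the level \<open>i\<close> of a vertex \<open>(i, j)\<close>, so \<open>u\<close> moves every vertex up by exactly this number.  It
  therefore defines a homomorphism from the transition group onto the integers, the \<^emph>\<open>level
  shift\<close>.

  Its kernel is the boundary group.  Removing the disc of radius one removes both vertices of
  level \<open>0\<close>, and so all edges between the two lines; what remains consists of pieces of
  \<open>c\<close>-lines with \<open>a\<close>-loops.  There a walk is closed if its \<open>c\<close>-exponent is \<open>0\<close>, and conversely a
  word of nonzero \<open>c\<close>-exponent can be read far up on a line, clear of the disc, along a walk that
  is not closed (\<open>outer_words_T\<close>).  Normality and the quotient are then the first
  isomorphism theorem.

  An element of the kernel permutes each level, a set of two vertices, and so its square is the
  identity.  The conjugates of \<open>a\<close> by the powers of \<open>c\<close> lie in the kernel and are pairwise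
  different, as each of them exchanges the two vertices of a different level; hence the kernel
  is infinite.\<close>

section \<open>Transition groups as images of words\<close>

lemma right_perm_group_mult:
  assumes "f \<in> Bij V" "g \<in> Bij V"
  shows "f \<otimes>\<^bsub>right_perm_group V\<^esub> g = compose V g f"
  using assms by (simp add: right_perm_group_def BijGroup_def)

lemma carrier_right_perm_group: "carrier (right_perm_group V) = Bij V"
  by (simp add: right_perm_group_def BijGroup_def)

lemma transition_group_mult_eq:
  "f \<otimes>\<^bsub>transition_group \<Gamma>\<^esub> g = f \<otimes>\<^bsub>right_perm_group (verts \<Gamma>)\<^esub> g"
  by (simp add: transition_group_def subgroup_generated_def)

lemma transition_group_one_eq: "\<one>\<^bsub>transition_group \<Gamma>\<^esub> = (\<lambda>v\<in>verts \<Gamma>. v)"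
  by (simp add: transition_group_def subgroup_generated_def right_perm_group_def BijGroup_def)

context transition_graph
begin

lemma transition_group_mult_apply:
  assumes "f \<in> carrier (transition_group \<Gamma>)" "g \<in> carrier (transition_group \<Gamma>)" "v \<in> verts \<Gamma>"
  shows "(f \<otimes>\<^bsub>transition_group \<Gamma>\<^esub> g) v = g (f v)"
proof -
  have "f \<in> Bij (verts \<Gamma>)" "g \<in> Bij (verts \<Gamma>)"
    using assms(1,2) carrier_transition_group_subset by blast+
  then show ?thesis
    using assms(3) by (simp add: transition_group_mult_eq right_perm_group_mult compose_eq)
qed

lemma word_perm_singleton:
  assumes "x \<in> alph \<Gamma>"
  shows "word_perm \<Gamma> [x] = letter_perm \<Gamma> x"
proof -
  interpret group "transition_group \<Gamma>" by (rule group_transition_group)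
  show ?thesis using letter_perm_carrier[OF assms] by (simp add: word_perm_def)
qed

lemma inv_letter_perm:
  assumes x: "x \<in> alph \<Gamma>"
  shows "inv\<^bsub>right_perm_group (verts \<Gamma>)\<^esub> letter_perm \<Gamma> x = letter_perm \<Gamma> (linv \<Gamma> x)"
proof (rule group.inv_equality[OF group_right_perm_group])
  let ?R = "right_perm_group (verts \<Gamma>)"
  have Bij: "letter_perm \<Gamma> (linv \<Gamma> x) \<in> Bij (verts \<Gamma>)" "letter_perm \<Gamma> x \<in> Bij (verts \<Gamma>)"
    by (simp_all only: carrier_right_perm_group[symmetric] letter_perm_Bij[OF x]
        letter_perm_Bij[OF linv_closed[OF x]])
  have "letter_perm \<Gamma> x (letter_perm \<Gamma> (linv \<Gamma> x) v) = v" if "v \<in> verts \<Gamma>" for v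
    using letter_perm_linv[OF that linv_closed[OF x]] by (simp only: linv_linv[OF x])
  then have "compose (verts \<Gamma>) (letter_perm \<Gamma> x) (letter_perm \<Gamma> (linv \<Gamma> x)) = (\<lambda>v\<in>verts \<Gamma>. v)"
    unfolding compose_def by (rule restrict_ext)
  then show "letter_perm \<Gamma> (linv \<Gamma> x) \<otimes>\<^bsub>?R\<^esub> letter_perm \<Gamma> x = \<one>\<^bsub>?R\<^esub>"
    unfolding right_perm_group_mult[OF Bij] by (simp add: right_perm_group_def BijGroup_def)
qed (simp_all only: letter_perm_Bij[OF x] letter_perm_Bij[OF linv_closed[OF x]])

text \<open>The generated subgroup also contains the inverses of its generators, which are
  permutations of letters again because the alphabet is closed under inversion.\<close>

lemma carrier_transition_group: "carrier (transition_group \<Gamma>) = word_perm \<Gamma> ` lists (alph \<Gamma>)"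
proof
  show "word_perm \<Gamma> ` lists (alph \<Gamma>) \<subseteq> carrier (transition_group \<Gamma>)"
    by (rule image_subsetI) (rule word_perm_carrier)
next
  show "carrier (transition_group \<Gamma>) \<subseteq> word_perm \<Gamma> ` lists (alph \<Gamma>)"
  proof
    fix g assume "g \<in> carrier (transition_group \<Gamma>)"
    then have "g \<in> generate (right_perm_group (verts \<Gamma>))
        (carrier (right_perm_group (verts \<Gamma>)) \<inter> letter_perm \<Gamma> ` alph \<Gamma>)"
      by (simp add: transition_group_def carrier_subgroup_generated)
    then show "g \<in> word_perm \<Gamma> ` lists (alph \<Gamma>)"
    proof (induction rule: generate.induct)
      case one
      have "\<one>\<^bsub>right_perm_group (verts \<Gamma>)\<^esub> = word_perm \<Gamma> []"
        by (simp add: word_perm_def transition_group_def)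
      then show ?case by (rule image_eqI) simp
    next
      case (incl h)
      then obtain x where x: "x \<in> alph \<Gamma>" "h = letter_perm \<Gamma> x" by (elim IntE imageE)
      then have "h = word_perm \<Gamma> [x]" by (simp add: word_perm_singleton)
      then show ?case by (rule image_eqI) (simp add: x(1))
    next
      case (inv h)
      then obtain x where x: "x \<in> alph \<Gamma>" "h = letter_perm \<Gamma> x" by (elim IntE imageE)
      then have "inv\<^bsub>right_perm_group (verts \<Gamma>)\<^esub> h = word_perm \<Gamma> [linv \<Gamma> x]"
        by (simp only: inv_letter_perm word_perm_singleton linv_closed)
      then show ?case by (rule image_eqI) (simp add: linv_closed[OF x(1)])
    next
      case (eng h1 h2)
      from eng.IH obtain u1 u2 where u: "u1 \<in> lists (alph \<Gamma>)" "u2 \<in> lists (alph \<Gamma>)"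
        and h: "h1 = word_perm \<Gamma> u1" "h2 = word_perm \<Gamma> u2" by (elim imageE)
      then have "h1 \<otimes>\<^bsub>right_perm_group (verts \<Gamma>)\<^esub> h2 = word_perm \<Gamma> (u1 @ u2)"
        by (simp only: word_perm_append transition_group_mult_eq)
      then show ?case using u by (intro image_eqI[of _ _ "u1 @ u2"]) simp_all
    qed
  qed
qed

lemma walk_verts: "walk \<Gamma> v u w \<Longrightarrow> v \<in> verts \<Gamma> \<and> w \<in> verts \<Gamma> \<and> u \<in> lists (alph \<Gamma>)"
proof (induction rule: walk.induct)
  case (Cons v x w u z)
  then show ?case using subsetD[OF edges_wf Cons.hyps(1)] by simp
qed simp

lemma walk_deterministic: "walk \<Gamma> v u w \<Longrightarrow> walk \<Gamma> v u w' \<Longrightarrow> w = w'"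
proof (induction arbitrary: w' rule: walk.induct)
  case (Nil v)
  from Nil.prems show ?case by cases auto
next
  case (Cons v x w u z)
  from Cons.prems
  obtain y where y: "(v, x, y) \<in> edges \<Gamma>" "walk \<Gamma> y u w'"
    by cases auto
  moreover have "v \<in> verts \<Gamma>" "x \<in> alph \<Gamma>" using subsetD[OF edges_wf Cons.hyps(1)] by simp_all
  ultimately have "y = w" using Cons.hyps(1) unique_out by blast
  then show ?case using Cons.IH y(2) by simp
qed

lemma word_perm_eqI:
  assumes "walk \<Gamma> v u w"
  shows "word_perm \<Gamma> u v = w"
proof (rule walk_deterministic[OF _ assms])
  show "walk \<Gamma> v u (word_perm \<Gamma> u v)"
    using walk_verts[OF assms] by (intro walk_word_perm) simp_all
qed

end

section \<open>The level shift\<close>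

interpretation T: rooted_graph T_graph "(0, 0)"
  by (rule rooted_graph_T)

lemma verts_T: "verts T_graph = UNIV \<times> {0, 1}"
  by (simp add: T_graph_def)

lemma lists_alph_T: "lists (alph T_graph) = UNIV"
proof -
  have "x \<in> alph T_graph" for x by (cases x) (simp_all add: T_graph_def)
  then have "alph T_graph = UNIV" by blast
  then show ?thesis by simp
qed

definition c_exponent :: "letter list \<Rightarrow> int" where
  "c_exponent u = int (count_list u Lc) - int (count_list u Lc_inv)"

lemma c_exponent_append: "c_exponent (u @ w) = c_exponent u + c_exponent w"
  by (simp add: c_exponent_def)

lemma c_exponent_replicate:
  "c_exponent (replicate n Lc) = int n" "c_exponent (replicate n Lc_inv) = - int n"
  by (induction n) (auto simp: c_exponent_def)

lemma c_exponent_surj: "\<exists>u. c_exponent u = k"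
  by (cases k rule: int_cases3)
     (metis c_exponent_replicate(1) of_nat_0, (metis c_exponent_replicate)+)

lemma abs_c_exponent_le: "\<bar>c_exponent u\<bar> \<le> int (length u)"
  by (induction u) (auto simp: c_exponent_def)

lemma edge_T_shift: "(v, x, w) \<in> edges T_graph \<Longrightarrow> fst w = fst v + c_exponent [x]"
  by (cases v; cases w; cases x) (simp_all add: T_edges_iff c_exponent_def)

lemma walk_T_shift: "walk T_graph v u w \<Longrightarrow> fst w = fst v + c_exponent u"
proof (induction rule: walk.induct)
  case (Nil v)
  then show ?case by (simp add: c_exponent_def)
next
  case (Cons v x w u z)
  have "c_exponent (x # u) = c_exponent [x] + c_exponent u" by (simp add: c_exponent_def)
  then show ?case using edge_T_shift[OF Cons.hyps(1)] Cons.IH by linarith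
qed

lemma word_perm_T_shift:
  "v \<in> verts T_graph \<Longrightarrow> fst (word_perm T_graph u v) = fst v + c_exponent u"
  by (rule walk_T_shift, rule T.walk_word_perm) (simp_all add: lists_alph_T)

text \<open>All vertices are moved by the same number of levels, so evaluating at the root loses
  nothing.\<close>

definition level_shift :: "(int \<times> nat \<Rightarrow> int \<times> nat) \<Rightarrow> int" where
  "level_shift g = fst (g (0, 0))"

lemma level_shift_word_perm: "level_shift (word_perm T_graph u) = c_exponent u"
  using word_perm_T_shift[of "(0, 0)" u] T.root by (simp add: level_shift_def)

lemma carrier_transition_group_T: "carrier (transition_group T_graph) = range (word_perm T_graph)"
  using T.carrier_transition_group by (simp add: lists_alph_T)

lemma group_hom_level_shift: "group_hom (transition_group T_graph) integer_group level_shift"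
proof (rule group_hom.intro[OF group_transition_group group_integer_group])
  show "group_hom_axioms (transition_group T_graph) integer_group level_shift"
  proof (unfold_locales, rule homI)
    fix g h assume "g \<in> carrier (transition_group T_graph)" "h \<in> carrier (transition_group T_graph)"
    then obtain u w where "g = word_perm T_graph u" "h = word_perm T_graph w"
      by (auto simp: carrier_transition_group_T)
    then show "level_shift (g \<otimes>\<^bsub>transition_group T_graph\<^esub> h)
        = level_shift g \<otimes>\<^bsub>integer_group\<^esub> level_shift h"
      by (simp add: lists_alph_T level_shift_word_perm c_exponent_append flip: T.word_perm_append)
  qed simp
qed

lemma level_shift_onto: "level_shift ` carrier (transition_group T_graph) = carrier integer_group"
  using c_exponent_surj
  by (auto simp: carrier_transition_group_T image_image level_shift_word_perm image_iff) metis

section \<open>The boundary group as a kernel\<close>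

lemma disc_T_level:
  assumes v: "v \<in> disc T_graph (0, 0) n"
  shows "\<bar>fst v\<bar> \<le> int n"
proof -
  from v
  obtain u where "walk T_graph (0, 0) u v"
    using T.connected[OF T.root, of v] by (auto simp: disc_def)
  then obtain w where w: "length w = path_dist T_graph (0, 0) v" "walk T_graph (0, 0) w v"
    using LeastI[of "\<lambda>n. \<exists>u. length u = n \<and> walk T_graph (0, 0) u v" "length u"]
    by (auto simp: path_dist_def)
  then have "\<bar>fst v\<bar> \<le> int (path_dist T_graph (0, 0) v)"
    using walk_T_shift[OF w(2)] abs_c_exponent_le[of w] by simp
  then show ?thesis using v by (simp add: disc_def)
qed

text \<open>The other vertex of level \<open>0\<close> is joined to the root by an \<open>a\<close>-edge.\<close>

lemma level_0_in_disc_T: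
  assumes "n \<ge> 1" and j: "j \<in> {0, 1}"
  shows "(0, j) \<in> disc T_graph (0, 0) n"
proof -
  have "\<exists>u. length u \<le> 1 \<and> walk T_graph (0, 0) u (0, j)"
  proof (cases "j = 0")
    case True
    then show ?thesis using walk.Nil[OF T.root] by (intro exI[of _ "[]"]) simp
  next
    case False
    then have "((0, 0), La, (0, j)) \<in> edges T_graph" using j by (simp add: T_edges_iff)
    moreover have "(0, j) \<in> verts T_graph" using j by (simp add: verts_T)
    ultimately show ?thesis by (intro exI[of _ "[La]"]) (auto intro: walk.intros)
  qed
  then obtain u where "length u \<le> 1" "walk T_graph (0, 0) u (0, j)" by blast
  then have "path_dist T_graph (0, 0) (0, j) \<le> 1"
    unfolding path_dist_def
    by (intro Least_le[THEN order_trans, of _ "length u"]) auto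
  then show ?thesis using assms by (simp add: disc_def verts_T)
qed

lemma walk_delete_verts: "walk (delete_verts \<Gamma> D) v u w \<Longrightarrow> walk \<Gamma> v u w"
  by (induction rule: walk.induct) (auto simp: delete_verts_def intro: walk.intros)

text \<open>Without level \<open>0\<close> there is no passage from one line to the other.\<close>

lemma walk_outside_disc_T_line:
  assumes "walk (delete_verts T_graph (disc T_graph (0, 0) n)) v u w" "n \<ge> 1"
  shows "snd w = snd v"
  using assms(1)
proof (induction rule: walk.induct)
  case (Cons v x w u z)
  then have e: "(v, x, w) \<in> edges T_graph" and "v \<notin> disc T_graph (0, 0) n"
    by (auto simp: delete_verts_def)
  moreover have "snd v \<in> {0, 1}" using e T.edges_wf by (auto simp: verts_T)
  ultimately have "fst v \<noteq> 0"
    using level_0_in_disc_T[OF assms(2)] by (cases v) fastforce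
  then have "snd w = snd v"
    using e by (cases v; cases w; cases x) (auto simp: T_edges_iff)
  then show ?case using Cons.IH by simp
qed simp

text \<open>Each letter changes the level by at most one, so a walk that starts far enough from the root
  does not meet the disc.\<close>

lemma far_walk_outside_disc_T:
  assumes "walk T_graph v u w" "fst v > int n + int (length u)"
  shows "walk (delete_verts T_graph (disc T_graph (0, 0) n)) v u w"
  using assms
proof (induction rule: walk.induct)
  case (Nil v)
  then show ?case using disc_T_level[of v n] by (intro walk.Nil) (auto simp: delete_verts_def)
next
  case (Cons v x w u z)
  have w: "fst w > int n + int (length u)"
    using Cons.prems edge_T_shift[OF Cons.hyps(1)] abs_c_exponent_le[of "[x]"] by simp
  then have "v \<notin> disc T_graph (0, 0) n" "w \<notin> disc T_graph (0, 0) n"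
    using Cons.prems disc_T_level[of v n] disc_T_level[of w n] by auto
  then show ?case using Cons.hyps(1) Cons.IH[OF w]
    by (intro walk.Cons[of _ _ w]) (simp_all add: delete_verts_def)
qed

lemma outer_words_T:
  assumes "n \<ge> 1"
  shows "outer_words T_graph (0, 0) n = {u. c_exponent u = 0}"
proof (intro Set.set_eqI iffI)
  fix u assume u: "u \<in> outer_words T_graph (0, 0) n"
  \<comment> \<open>A vertex so high that reading \<open>u\<close> from it cannot reach the disc.\<close>
  define v :: "int \<times> nat" where "v = (int n + int (length u) + 1, 0)"
  have v: "v \<in> verts T_graph" by (simp add: v_def verts_T)
  have w: "walk T_graph v u (word_perm T_graph u v)"
    by (rule T.walk_word_perm[OF _ v]) (simp add: lists_alph_T)
  have "walk (delete_verts T_graph (disc T_graph (0, 0) n)) v u (word_perm T_graph u v)"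
    by (rule far_walk_outside_disc_T[OF w]) (simp add: v_def)
  then have "word_perm T_graph u v = v" using u unfolding outer_words_def by fastforce
  then show "u \<in> {u. c_exponent u = 0}" using word_perm_T_shift[OF v, of u] by simp
next
  fix u assume u: "u \<in> {u. c_exponent u = 0}"
  show "u \<in> outer_words T_graph (0, 0) n"
    unfolding outer_words_def
  proof (intro CollectI conjI allI impI)
    fix v w assume w: "walk (delete_verts T_graph (disc T_graph (0, 0) n)) v u w"
    show "v = w"
      using walk_outside_disc_T_line[OF w assms] walk_T_shift[OF walk_delete_verts[OF w]] u
      by (simp add: prod_eq_iff)
  qed (simp add: lists_alph_T)
qed

lemma boundary_group_T_eq_kernel:
  assumes "n \<ge> 1"
  shows "boundary_group T_graph (0, 0) n
    = kernel (transition_group T_graph) integer_group level_shift"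
  using level_shift_word_perm
  by (auto simp: boundary_group_def outer_words_T[OF assms] kernel_def carrier_transition_group_T)

section \<open>The elements of the kernel\<close>

text \<open>An element of the kernel maps each level to itself, and a permutation of two vertices is an
  involution.\<close>

lemma kernel_level_shift_square:
  assumes g: "g \<in> kernel (transition_group T_graph) integer_group level_shift"
  shows "g \<otimes>\<^bsub>transition_group T_graph\<^esub> g = \<one>\<^bsub>transition_group T_graph\<^esub>"
proof -
  interpret group "transition_group T_graph" by (rule group_transition_group)
  have gc: "g \<in> carrier (transition_group T_graph)" using g by (simp add: kernel_def)
  then obtain u where u: "g = word_perm T_graph u" by (auto simp: carrier_transition_group_T)
  then have u0: "c_exponent u = 0" using g by (simp add: kernel_def level_shift_word_perm)
  have bij: "bij_betw g (verts T_graph) (verts T_graph)"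
    using subsetD[OF T.carrier_transition_group_subset gc] by (simp add: Bij_def)
  have fst_g: "fst (g v) = fst v" if "v \<in> verts T_graph" for v
    using word_perm_T_shift[OF that, of u] u u0 by simp
  have "g (g v) = v" if v: "v \<in> verts T_graph" for v
  proof (cases "g v = v")
    case False
    \<comment> \<open>By injectivity \<open>g (g v)\<close> differs from \<open>g v\<close>, and the level has no third vertex.\<close>
    have gv: "g v \<in> verts T_graph" "g (g v) \<in> verts T_graph"
      using bij v by (auto simp: bij_betw_def)
    have ne: "g (g v) \<noteq> g v" using False inj_onD[OF bij_betw_imp_inj_on[OF bij] _ gv(1) v] by blast
    have "fst (g v) = fst v" "fst (g (g v)) = fst v" using fst_g v gv by auto
    moreover have "snd v \<in> {0, 1}" "snd (g v) \<in> {0, 1}" "snd (g (g v)) \<in> {0, 1}"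
      using v gv by (auto simp: verts_T mem_Times_iff)
    ultimately show ?thesis using False ne by (auto simp: prod_eq_iff)
  qed simp
  then have eq: "(g \<otimes>\<^bsub>transition_group T_graph\<^esub> g) v = \<one>\<^bsub>transition_group T_graph\<^esub> v"
    if "v \<in> verts T_graph" for v
    using that gc by (simp add: T.transition_group_mult_apply transition_group_one_eq)
  have "h \<in> extensional (verts T_graph)" if "h \<in> carrier (transition_group T_graph)" for h
    using subsetD[OF T.carrier_transition_group_subset that] by (simp add: Bij_def)
  then show ?thesis by (intro extensionalityI[OF _ _ eq]) (use gc in auto)
qed

definition conjugate_word :: "nat \<Rightarrow> letter list" where
  "conjugate_word n = replicate n Lc @ [La] @ replicate n Lc_inv"

lemma c_exponent_conjugate_word: "c_exponent (conjugate_word n) = 0"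
proof -
  have "c_exponent [La] = 0" by (simp add: c_exponent_def)
  then show ?thesis by (simp add: conjugate_word_def c_exponent_append c_exponent_replicate
        del: append_Cons append_Nil)
qed

text \<open>Reading this word from level \<open>-m\<close> meets the letter \<open>a\<close> at level \<open>n - m\<close>, so that only the
  vertices of level \<open>-n\<close> can be moved.\<close>

lemma conjugate_word_perm:
  "word_perm T_graph (conjugate_word n) (- int m, 0) = (- int m, if m = n then 1 else 0)"
proof (rule T.word_perm_eqI)
  let ?i = "- int m + int n" and ?j = "if m = n then 1 else 0 :: nat"
  have "((?i, 0), La, (?i, ?j)) \<in> edges T_graph" by (simp add: T_edges_iff)
  then have mid: "walk T_graph (?i, 0) [La] (?i, ?j)"
    by (rule walk.Cons) (rule walk.Nil, simp add: verts_T)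
  have down: "walk T_graph (?i, ?j) (replicate n Lc_inv) (- int m, ?j)"
    using walk_T_down[of ?j ?i n] by simp
  show "walk T_graph (- int m, 0) (conjugate_word n) (- int m, ?j)"
    unfolding conjugate_word_def
    by (intro walk_append[OF walk_T_up] walk_append[OF mid down]) simp
qed

lemma infinite_kernel_level_shift:
  "infinite (kernel (transition_group T_graph) integer_group level_shift)"
proof (rule infinite_super)
  show "range (\<lambda>n. word_perm T_graph (conjugate_word n))
      \<subseteq> kernel (transition_group T_graph) integer_group level_shift"
    by (auto simp: kernel_def carrier_transition_group_T level_shift_word_perm
        c_exponent_conjugate_word)
  have "inj (\<lambda>n. word_perm T_graph (conjugate_word n))"
  proof (rule injI)
    fix m n assume "word_perm T_graph (conjugate_word m) = word_perm T_graph (conjugate_word n)"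
    then have "(- int m, if m = m then 1 else 0 :: nat) = (- int m, if m = n then 1 else 0)"
      by (simp only: flip: conjugate_word_perm)
    then show "m = n" by (simp split: if_splits)
  qed
  then show "infinite (range (\<lambda>n. word_perm T_graph (conjugate_word n)))"
    by (rule range_inj_infinite)
qed

theorem proposition10p6:
  fixes G :: "(int \<times> nat \<Rightarrow> int \<times> nat) monoid"
    and B :: "(int \<times> nat \<Rightarrow> int \<times> nat) set"
  defines "G \<equiv> transition_group T_graph"
    and "B \<equiv> boundary_group T_graph (0, 0) 1"
  shows "infinite B \<and> B \<lhd> G
    \<and> (\<forall>g\<in>B. \<exists>n>0. g [^]\<^bsub>G\<^esub> (n::nat) = \<one>\<^bsub>G\<^esub>)
    \<and> (\<forall>g\<in>B. g \<noteq> \<one>\<^bsub>G\<^esub> \<longrightarrow> group.ord G g = 2)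
    \<and> G Mod B \<cong> integer_group"
proof -
  interpret shift: group_hom G integer_group level_shift
    unfolding G_def by (rule group_hom_level_shift)
  have B: "B = kernel G integer_group level_shift"
    by (simp add: B_def G_def boundary_group_T_eq_kernel)
  have gc: "g \<in> carrier G" if "g \<in> B" for g
    using that by (simp add: B kernel_def)
  have square: "g [^]\<^bsub>G\<^esub> (2::nat) = \<one>\<^bsub>G\<^esub>" if "g \<in> B" for g
    using kernel_level_shift_square[of g] that gc[OF that]
    by (simp add: B numeral_2_eq_2 flip: G_def)
  have "group.ord G g = 2" if g: "g \<in> B" "g \<noteq> \<one>\<^bsub>G\<^esub>" for g
  proof -
    have "group.ord G g dvd 2" using square[OF g(1)] gc[OF g(1)] shift.G.pow_eq_id by blast
    moreover have "group.ord G g \<noteq> 1" using g gc shift.G.ord_eq_1 by blast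
    ultimately show ?thesis using prime_nat_iff two_is_prime_nat by blast
  qed
  moreover have "infinite B" using infinite_kernel_level_shift by (simp add: B G_def)
  moreover have "B \<lhd> G" using shift.normal_kernel by (simp add: B)
  moreover have "G Mod B \<cong> integer_group"
    using shift.FactGroup_iso level_shift_onto by (simp add: B G_def)
  ultimately show ?thesis using square by (metis zero_less_numeral)
qed

end
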